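(* Let $H=(V,E)$ be a hypergraph with $n=|V|$ and let $e\in E$. For $1\leq i\leq n$ let $$a_i=\sum_{\substack{F\subseteq E\\ k(F)=i}}(-1)^{|F|},$$ and for $1\leq i,j\leq n$ let $$b_e^{i,j}=\sum_{F\in\mathcal{B}_e^{i,j}}(-1)^{|F|},\qquad \mathcal{B}_e^{i,j}=\{F\subseteq E\mid e\in F,\ k(F)=i,\ k(F\setminus\{e\})=j\}.$$ Then for every $i=1,\dots,n$, $$a_i=\sum_{i<j\leq n}b_e^{i,j}-\sum_{1\leq j<i}b_e^{j,i}.$$
   Context: A hypergraph is a pair $H=(V,E)$ where $V$ is a finite non-empty set (vertices) and $E$ is a set of subsets of $V$ (edges), each of cardinality at least $2$. Two distinct vertices are neighbours if some edge contains both; connectedness of vertices is the equivalence relation generated by being neighbours, and the connected components are given by its equivalence classes. For $F\subseteq E$, $k(F)$ denotes the number of connected components of the spanning subgraph $(V,F)$ (isolated vertices count as components). The numbers $a_i$ are the coefficients of the chromatic polynomial of $H$, $\chi_H(\lambda)=\sum_{i=1}^n a_i\lambda^i$. *)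

theory Defs
  imports Main
begin

definition hypergraph :: "'a set \<Rightarrow> 'a set set \<Rightarrow> bool" where
  "hypergraph V E \<longleftrightarrow> finite V \<and> V \<noteq> {} \<and> (\<forall>f\<in>E. f \<subseteq> V \<and> 2 \<le> card f)"

definition neighbours :: "'a set set \<Rightarrow> ('a \<times> 'a) set" where
  "neighbours F = {(u, v). u \<noteq> v \<and> (\<exists>f\<in>F. u \<in> f \<and> v \<in> f)}"

(* The neighbour relation is symmetric, so its reflexive transitive closure is already
   the generated equivalence relation; it is cut down to V because rtrancl is reflexive
   on the whole type. *)
definition connectedness :: "'a set \<Rightarrow> 'a set set \<Rightarrow> ('a \<times> 'a) set" where
  "connectedness V F = (neighbours F)\<^sup>* \<inter> (V \<times> V)"

lemma equiv_connectedness: "equiv V (connectedness V F)"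
proof (rule equivI)
  show "connectedness V F \<subseteq> V \<times> V" "refl_on V (connectedness V F)"
    by (auto simp: connectedness_def refl_on_def)
  have "sym ((neighbours F)\<^sup>*)"
    by (rule sym_rtrancl) (auto simp: neighbours_def sym_def)
  then show "sym (connectedness V F)"
    by (auto simp: connectedness_def sym_def)
  show "trans (connectedness V F)"
    by (auto simp: connectedness_def trans_def)
qed

lemma connectedness_least:
  assumes "\<forall>f\<in>F. f \<subseteq> V" and R: "equiv V R" and "neighbours F \<subseteq> R"
  shows "connectedness V F \<subseteq> R"
proof -
  have "(u, v) \<in> R" if "(u, v) \<in> (neighbours F)\<^sup>*" "u \<in> V" for u v
    using that
  proof (induction rule: rtrancl_induct)
    case base
    then show ?case using R by (auto simp: equiv_def refl_on_def)
  next
    case (step y z)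
    then show ?case using R assms(3) by (meson equivE subsetD transD)
  qed
  then show ?thesis by (auto simp: connectedness_def)
qed

definition num_components :: "'a set \<Rightarrow> 'a set set \<Rightarrow> nat" where
  "num_components V F = card (V // connectedness V F)"

definition chromatic_coeff :: "'a set \<Rightarrow> 'a set set \<Rightarrow> nat \<Rightarrow> int" where
  "chromatic_coeff V E i = (\<Sum>F | F \<subseteq> E \<and> num_components V F = i. (-1) ^ card F)"

definition edge_drop_family :: "'a set \<Rightarrow> 'a set set \<Rightarrow> 'a set \<Rightarrow> nat \<Rightarrow> nat \<Rightarrow> 'a set set set" where
  "edge_drop_family V E e i j =
     {F. F \<subseteq> E \<and> e \<in> F \<and> num_components V F = i \<and> num_components V (F - {e}) = j}"

definition edge_drop_coeff :: "'a set \<Rightarrow> 'a set set \<Rightarrow> 'a set \<Rightarrow> nat \<Rightarrow> nat \<Rightarrow> int" where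
  "edge_drop_coeff V E e i j = (\<Sum>F\<in>edge_drop_family V E e i j. (-1) ^ card F)"

end

theory Submission
  imports Defs
begin

text \<open>Pairing each edge set \<open>F\<close> containing \<open>e\<close> with \<open>F - {e}\<close>, which has the opposite sign,
  turns \<open>a\<^sub>i\<close> into a signed sum over the \<open>F\<close> containing \<open>e\<close>. The pairs with
  \<open>k F = k (F - {e})\<close> cancel, and the rest have \<open>k F < k (F - {e})\<close>, since removing an edge
  never decreases the number of components.\<close>

text \<open>Fewer edges generate a finer equivalence relation, and every class of the coarser one is
  a union of classes of the finer one.\<close>

lemma num_components_antimono:
  assumes "finite V" "F \<subseteq> G"
  shows "num_components V G \<le> num_components V F"
  unfolding num_components_def
proof (rule finite_refines_card_le)
  show "finite (V // connectedness V F)"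
    using assms(1) by (simp add: quotient_def)
  have "neighbours F \<subseteq> neighbours G"
    using assms(2) by (auto simp: neighbours_def)
  then show "connectedness V F \<subseteq> connectedness V G"
    unfolding connectedness_def by (intro Int_mono rtrancl_mono order_refl)
qed (rule equiv_connectedness)+

lemma num_components_bounds:
  assumes "finite V" "V \<noteq> {}"
  shows "1 \<le> num_components V F" "num_components V F \<le> card V"
proof -
  have *: "V // connectedness V F = (\<lambda>x. connectedness V F `` {x}) ` V"
    by (auto simp: quotient_def)
  show "1 \<le> num_components V F"
    using assms by (simp add: num_components_def * Suc_le_eq card_gt_0_iff)
  show "num_components V F \<le> card V"
    using assms(1) by (simp add: num_components_def * card_image_le)
qed

text \<open>Deleting \<open>e\<close> is a bijection from the subsets of \<open>E\<close> that
  contain \<open>e\<close> onto those that do not, with inverse \<open>insert e\<close>.\<close>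

lemma sum_Pow_split_element:
  fixes g :: "'b set \<Rightarrow> 'c::comm_monoid_add"
  assumes "finite E" "e \<in> E"
  shows "(\<Sum>F\<in>Pow E. g F) = (\<Sum>F | F \<subseteq> E \<and> e \<in> F. g F + g (F - {e}))"
proof -
  let ?S = "{F. F \<subseteq> E \<and> e \<in> F}"
  have fin: "finite ?S" using assms(1) by simp
  have "F \<in> (\<lambda>F. F - {e}) ` ?S" if "F \<subseteq> E" "e \<notin> F" for F
    using that assms(2) by (intro image_eqI[of _ _ "insert e F"]) auto
  then have "Pow E = ?S \<union> (\<lambda>F. F - {e}) ` ?S"
    by auto
  moreover have "inj_on (\<lambda>F. F - {e}) ?S"
    by (auto simp: inj_on_def)
  moreover have "?S \<inter> (\<lambda>F. F - {e}) ` ?S = {}"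
    by auto
  ultimately show ?thesis
    using fin by (simp add: sum.union_disjoint sum.reindex sum.distrib)
qed

text \<open>Each \<open>F\<close> containing \<open>e\<close> lies in the family of exactly one
  index pair, so after exchanging the sums the inner one has at most one nonzero term. Leaving
  \<open>P\<close> arbitrary lets both sums of the theorem be treated alike.\<close>

lemma sum_edge_drop_coeff:
  assumes "finite E" "finite P"
  shows "(\<Sum>(i, j)\<in>P. edge_drop_coeff V E e i j) =
    (\<Sum>F | F \<subseteq> E \<and> e \<in> F.
       if (num_components V F, num_components V (F - {e})) \<in> P then (-1) ^ card F else 0)"
proof -
  let ?S = "{F. F \<subseteq> E \<and> e \<in> F}"
  let ?k = "\<lambda>F. (num_components V F, num_components V (F - {e}))"
  have fin: "finite ?S" using assms(1) by simp
  have "edge_drop_coeff V E e i j = (\<Sum>F\<in>?S. if ?k F = (i, j) then (-1) ^ card F else 0)"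
    for i j
  proof -
    have "edge_drop_family V E e i j = {F \<in> ?S. ?k F = (i, j)}"
      by (auto simp: edge_drop_family_def)
    then show ?thesis
      unfolding edge_drop_coeff_def using fin by (simp only: sum.inter_filter)
  qed
  then have "(\<Sum>(i, j)\<in>P. edge_drop_coeff V E e i j) =
      (\<Sum>p\<in>P. \<Sum>F\<in>?S. if ?k F = p then (-1) ^ card F else 0)"
    by (simp only: case_prod_unfold prod.collapse)
  also have "\<dots> = (\<Sum>F\<in>?S. \<Sum>p\<in>P. if ?k F = p then (-1) ^ card F else 0)"
    by (rule sum.swap)
  finally show ?thesis
    using assms(2) by (simp only: sum.delta')
qed

theorem mainTheorem3:
  fixes V :: "'a set" and E :: "'a set set" and e :: "'a set" and n i :: nat
  assumes "hypergraph V E"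
    and "n = card V"
    and "e \<in> E"
    and "1 \<le> i" and "i \<le> n"
  shows "chromatic_coeff V E i =
    (\<Sum>j\<in>{i<..n}. edge_drop_coeff V E e i j) - (\<Sum>j\<in>{1..<i}. edge_drop_coeff V E e j i)"
proof -
  have V: "finite V" "V \<noteq> {}" and "E \<subseteq> Pow V"
    using assms(1) by (auto simp: hypergraph_def)
  then have finE: "finite E"
    by (meson finite_Pow_iff finite_subset)
  let ?S = "{F. F \<subseteq> E \<and> e \<in> F}"
  let ?k = "num_components V"
  let ?s = "\<lambda>F. (-1) ^ card F :: int"
  have "chromatic_coeff V E i = (\<Sum>F\<in>Pow E. if ?k F = i then ?s F else 0)"
    using finE by (simp add: chromatic_coeff_def flip: sum.inter_filter)
  also have "\<dots> = (\<Sum>F\<in>?S. (if ?k F = i then ?s F else 0) +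
      (if ?k (F - {e}) = i then ?s (F - {e}) else 0))"
    by (rule sum_Pow_split_element[OF finE assms(3)])
  \<comment> \<open>The conditions are phrased as membership in a product to match
    \<open>sum_edge_drop_coeff\<close>.\<close>
  also have "\<dots> = (\<Sum>F\<in>?S. (if (?k F, ?k (F - {e})) \<in> {i} \<times> {i<..n} then ?s F else 0) -
      (if (?k F, ?k (F - {e})) \<in> {1..<i} \<times> {i} then ?s F else 0))"
  proof (rule sum.cong[OF refl])
    fix F assume F: "F \<in> ?S"
    then have "finite F" using finE finite_subset by blast
    then have "card F = Suc (card (F - {e}))"
      using F by (intro card.remove) auto
    then have "?s (F - {e}) = - ?s F" by simp
    moreover have "?k F \<le> ?k (F - {e})"
      by (rule num_components_antimono[OF V(1)]) auto
    \<comment> \<open>These bounds ensure that the two index ranges miss no pair with distinct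
      component counts.\<close>
    moreover have "1 \<le> ?k F" "?k (F - {e}) \<le> n"
      using num_components_bounds[OF V] assms(2) by auto
    \<comment> \<open>If both counts equal \<open>i\<close>, the left side cancels and neither
      product contains the pair. If only \<open>?k F\<close> is \<open>i\<close>, the other count is
      larger; if only \<open>?k (F - {e})\<close> is \<open>i\<close>, then \<open>?k F\<close> is
      smaller and the sign flip gives the minus.\<close>
    ultimately show "(if ?k F = i then ?s F else 0) +
        (if ?k (F - {e}) = i then ?s (F - {e}) else 0) =
      (if (?k F, ?k (F - {e})) \<in> {i} \<times> {i<..n} then ?s F else 0) -
      (if (?k F, ?k (F - {e})) \<in> {1..<i} \<times> {i} then ?s F else 0)"
      by auto
  qed
  also have "\<dots> = (\<Sum>(i, j)\<in>{i} \<times> {i<..n}. edge_drop_coeff V E e i j) -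
      (\<Sum>(i, j)\<in>{1..<i} \<times> {i}. edge_drop_coeff V E e i j)"
    using finE by (simp only: sum_subtractf sum_edge_drop_coeff finite_SigmaI finite.intros
        finite_greaterThanAtMost finite_atLeastLessThan)
  also have "\<dots> = (\<Sum>j\<in>{i<..n}. edge_drop_coeff V E e i j) -
      (\<Sum>j\<in>{1..<i}. edge_drop_coeff V E e j i)"
    \<comment> \<open>The singleton factor leaves one free index, which is the first one in the
      subtracted sum.\<close>
    by (simp flip: sum.cartesian_product)
  finally show ?thesis .
qed

end
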